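(* For all integers $k\ge 0$ and $n\ge 1$, $$\sum_{\lambda\in\Lambda_n^k} m_{n,k}^{\lambda}\, s_{\lambda}(\boldsymbol{x})=\sum_{j=0}^{\min(n,k)} S(k,j)\, h_{(n-j,1^j)}(\boldsymbol{x}),$$ where if $j=n$ the integer partition $(n-j,1^j)$ is just $(1^n)$.
   Context: Integer partitions are identified with their Young diagrams and ordered by containment. $\Lambda_n^k=\{\lambda\vdash n:\ \lambda_1\ge n-k\}$. An $n$-vacillating tableau of shape $\lambda$ and length $2k$ is a sequence of integer partitions $((n)=\lambda^{(0)},\lambda^{(1/2)},\lambda^{(1)},\dots,\lambda^{(k-1/2)},\lambda^{(k)}=\lambda)$ such that for each integer $j=0,\dots,k-1$: (a) $\lambda^{(j)}\supseteq\lambda^{(j+1/2)}$ and $|\lambda^{(j)}/\lambda^{(j+1/2)}|=1$; (b) $\lambda^{(j+1/2)}\subseteq\lambda^{(j+1)}$ and $|\lambda^{(j+1)}/\lambda^{(j+1/2)}|=1$. $m_{n,k}^{\lambda}$ is the number of $n$-vacillating tableaux of shape $\lambda$ and length $2k$. $s_\lambda(\boldsymbol{x})$ is the Schur function in $\boldsymbol{x}=(x_1,x_2,\dots)$. $S(k,j)$ is the Stirling number of the second kind, with $S(0,0)=1$ and $S(0,j)=0$ for $j\ge1$. $h_0=1$, $h_r=\sum_{i_1\le\cdots\le i_r}x_{i_1}\cdots x_{i_r}$ for $r\ge 1$, and $h_\lambda=h_{\lambda_1}h_{\lambda_2}\cdots$ (complete symmetric functions); so $h_{(n-j,1^j)}=h_{n-j}h_1^j$.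 *)

theory Defs
  imports Main "HOL-Library.Multiset" "HOL-Combinatorics.Stirling"
begin

text \<open>
  The variable \<open>x\<^sub>i\<close> of the literature is indexed here by \<open>i - 1\<close>, so that
  the index set is all of \<^typ>\<open>nat\<close>.  A finite multiset \<open>M\<close> of indices stands for the
  monomial \<open>\<Prod>i\<in>#M. x\<^sub>i\<close>, and a series is the function giving the coefficient of each monomial.
\<close>

typedef power_series = "UNIV :: (nat multiset \<Rightarrow> int) set"
  morphisms coeff Abs_power_series
  by simp

setup_lifting type_definition_power_series

lemma finite_submultisets: "finite {A. A \<subseteq># (M :: 'a multiset)}"
proof (induction M)
  case empty
  then show ?case by simp
next
  case (add x M)
  have "{A. A \<subseteq># add_mset x M} \<subseteq> {A. A \<subseteq># M} \<union> add_mset x ` {A. A \<subseteq># M}"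
  proof
    fix A assume A: "A \<in> {A. A \<subseteq># add_mset x M}"
    show "A \<in> {A. A \<subseteq># M} \<union> add_mset x ` {A. A \<subseteq># M}"
    proof (cases "x \<in># A")
      case True
      then obtain B where "A = add_mset x B" by (meson multi_member_split)
      with A show ?thesis by auto
    next
      case False
      with A have "A \<subseteq># M"
        using subset_eq_diff_conv[of A "{#x#}" M] by (simp add: diff_single_trivial)
      then show ?thesis by simp
    qed
  qed
  with add show ?case by (meson finite_UnI finite_imageI finite_subset)
qed

instantiation power_series :: comm_ring_1
begin

lift_definition zero_power_series :: power_series is "\<lambda>_. 0" .

lift_definition one_power_series :: power_series is "\<lambda>M. if M = {#} then 1 else 0" .

lift_definition plus_power_series :: "power_series \<Rightarrow> power_series \<Rightarrow> power_series"
  is "\<lambda>f g M. f M + g M" .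

lift_definition minus_power_series :: "power_series \<Rightarrow> power_series \<Rightarrow> power_series"
  is "\<lambda>f g M. f M - g M" .

lift_definition uminus_power_series :: "power_series \<Rightarrow> power_series"
  is "\<lambda>f M. - f M" .

lift_definition times_power_series :: "power_series \<Rightarrow> power_series \<Rightarrow> power_series"
  is "\<lambda>f g M. \<Sum>A | A \<subseteq># M. f A * g (M - A)" .

instance
proof
  fix a b c :: power_series
  show "a * b * c = a * (b * c)"
  proof (transfer, rule ext)
    fix f g h :: "nat multiset \<Rightarrow> int" and M :: "nat multiset"
    have "(\<Sum>A | A \<subseteq># M. (\<Sum>B | B \<subseteq># A. f B * g (A - B)) * h (M - A))
        = (\<Sum>(A, B) \<in> (SIGMA A:{A. A \<subseteq># M}. {B. B \<subseteq># A}). f B * g (A - B) * h (M - A))"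
      by (simp add: sum_distrib_right sum.Sigma finite_submultisets)
    also have "\<dots> = (\<Sum>(B, C) \<in> (SIGMA B:{B. B \<subseteq># M}. {C. C \<subseteq># M - B}). f B * (g C * h (M - B - C)))"
    proof (rule sum.reindex_bij_witness
        [where i = "\<lambda>(B, C). (B + C, B)" and j = "\<lambda>(A, B). (B, A - B)"], goal_cases)
      case (1 p)
      then show ?case by auto
    next
      case (2 p)
      then show ?case
        by (auto simp: subseteq_mset_def intro!: diff_le_mono intro: order_trans)
    next
      case (3 p)
      then show ?case by auto
    next
      case (4 p)
      then obtain B C where p: "p = (B, C)" "B \<subseteq># M" "C \<subseteq># M - B" by auto
      then have "B + C \<subseteq># M"
        using subset_mset.le_diff_conv2 by (metis add.commute)
      with p show ?case by simp
    next
      case (5 p)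
      then obtain A B where p: "p = (A, B)" "A \<subseteq># M" "B \<subseteq># A" by auto
      then have "M - B - (A - B) = M - A"
        by (metis diff_diff_add_mset subset_mset.add_diff_inverse)
      with p show ?case by (simp add: mult.assoc)
    qed
    also have "\<dots> = (\<Sum>B | B \<subseteq># M. f B * (\<Sum>C | C \<subseteq># M - B. g C * h (M - B - C)))"
      by (simp add: sum_distrib_left sum.Sigma finite_submultisets)
    finally show "(\<Sum>A | A \<subseteq># M. (\<Sum>B | B \<subseteq># A. f B * g (A - B)) * h (M - A))
        = (\<Sum>B | B \<subseteq># M. f B * (\<Sum>C | C \<subseteq># M - B. g C * h (M - B - C)))" .
  qed
  show "a * b = b * a"
  proof (transfer, rule ext)
    fix f g :: "nat multiset \<Rightarrow> int" and M :: "nat multiset"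
    have inv: "M - (M - A) = A" if "A \<subseteq># M" for A
      using that by (simp add: multiset_eq_iff subseteq_mset_def)
    show "(\<Sum>A | A \<subseteq># M. f A * g (M - A)) = (\<Sum>A | A \<subseteq># M. g A * f (M - A))"
      by (rule sum.reindex_bij_witness[where i = "\<lambda>A. M - A" and j = "\<lambda>A. M - A"])
        (auto simp: inv mult.commute)
  qed
  show "1 * a = a"
  proof (transfer, rule ext)
    fix f :: "nat multiset \<Rightarrow> int" and M :: "nat multiset"
    have "(\<Sum>A | A \<subseteq># M. (if A = {#} then 1 else 0) * f (M - A))
        = (\<Sum>A | A \<subseteq># M. if A = {#} then f M else 0)"
      by (rule sum.cong) auto
    also have "\<dots> = f M"
      by (simp add: sum.delta finite_submultisets)
    finally show "(\<Sum>A | A \<subseteq># M. (if A = {#} then 1 else 0) * f (M - A)) = f M" .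
  qed
  show "(a + b) * c = a * c + b * c"
    by transfer (simp add: distrib_right sum.distrib)
  show "(0 :: power_series) \<noteq> 1"
    by transfer (metis zero_neq_one)
qed (transfer; simp add: algebra_simps)+

end

text \<open>
  The series \<open>\<Sum>a\<in>A. x\<^bsup>w a\<^esup>\<close>.  It is only meaningful when each set \<open>{a \<in> A. w a = M}\<close> is
  finite, since \<^const>\<open>card\<close> is 0 on infinite sets; this is shown below for each use.
\<close>

lift_definition gen_series :: "'a set \<Rightarrow> ('a \<Rightarrow> nat multiset) \<Rightarrow> power_series"
  is "\<lambda>A w M. int (card {a \<in> A. w a = M})" .

definition is_partition :: "nat list \<Rightarrow> bool" where
  "is_partition lam \<longleftrightarrow> sorted_wrt (\<ge>) lam \<and> 0 \<notin> set lam"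

definition partition_of :: "nat list \<Rightarrow> nat \<Rightarrow> bool" (infix "\<turnstile>\<^sub>p" 50) where
  "lam \<turnstile>\<^sub>p n \<longleftrightarrow> is_partition lam \<and> sum_list lam = n"

definition first_part :: "nat list \<Rightarrow> nat" where
  "first_part lam = (case lam of [] \<Rightarrow> 0 | a # _ \<Rightarrow> a)"

definition diagram :: "nat list \<Rightarrow> (nat \<times> nat) set" where
  "diagram lam = {(i, j). i < length lam \<and> j < lam ! i}"

definition Lam :: "nat \<Rightarrow> nat \<Rightarrow> nat list set" where
  "Lam n k = {lam. lam \<turnstile>\<^sub>p n \<and> int (first_part lam) \<ge> int n - int k}"

definition adds_box :: "nat list \<Rightarrow> nat list \<Rightarrow> bool" where
  "adds_box \<mu> lam \<longleftrightarrow> diagram \<mu> \<subseteq> diagram lam \<and> card (diagram lam - diagram \<mu>) = 1"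

text \<open>The entry \<open>t ! i\<close> is the partition with the half-integral index \<open>i / 2\<close>.\<close>

definition vacillating_tableaux :: "nat \<Rightarrow> nat \<Rightarrow> nat list \<Rightarrow> nat list list set" where
  "vacillating_tableaux n k lam =
    {t. length t = 2 * k + 1 \<and> (\<forall>\<mu> \<in> set t. is_partition \<mu>) \<and>
        t ! 0 = [n] \<and> t ! (2 * k) = lam \<and>
        (\<forall>j < k. adds_box (t ! (2 * j + 1)) (t ! (2 * j)) \<and>
                 adds_box (t ! (2 * j + 1)) (t ! (2 * j + 2)))}"

definition num_vacillating :: "nat \<Rightarrow> nat \<Rightarrow> nat list \<Rightarrow> nat" where
  "num_vacillating n k lam = card (vacillating_tableaux n k lam)"

definition SSYT :: "nat list \<Rightarrow> nat list list set" where
  "SSYT lam = {T. map length T = lam \<and> (\<forall>row \<in> set T. sorted row) \<and>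
     (\<forall>i j. Suc i < length T \<and> j < length (T ! i) \<and> j < length (T ! Suc i) \<longrightarrow>
        T ! i ! j < T ! Suc i ! j)}"

definition schur :: "nat list \<Rightarrow> power_series" where
  "schur lam = gen_series (SSYT lam) (\<lambda>T. mset (concat T))"

definition complete_h :: "nat \<Rightarrow> power_series" where
  "complete_h r = gen_series {is. sorted is \<and> length is = r} mset"

definition complete_h_partition :: "nat list \<Rightarrow> power_series" where
  "complete_h_partition lam = (\<Prod>r\<leftarrow>lam. complete_h r)"

text \<open>The partition \<open>(n - j, 1\<^sup>j)\<close> for \<open>j \<le> n\<close>, with no zero part when \<open>j = n\<close>.\<close>

definition hook :: "nat \<Rightarrow> nat \<Rightarrow> nat list" where
  "hook n j = (if j = n then replicate n 1 else (n - j) # replicate j 1)"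

lemma finite_complete_h_fibre: "finite {is. is \<in> {is. sorted is \<and> length is = r} \<and> mset is = M}"
proof -
  obtain ys where "mset ys = M" by (metis ex_mset)
  then show ?thesis
    by (intro finite_subset[OF _ mset_eq_finite[of ys]]) auto
qed

lemma finite_SSYT_fibre: "finite {T \<in> SSYT lam. mset (concat T) = M}"
proof (rule finite_subset)
  let ?R = "{xs. set xs \<subseteq> set_mset M \<and> length xs \<le> size M}"
  show "{T \<in> SSYT lam. mset (concat T) = M} \<subseteq> {T. set T \<subseteq> ?R \<and> length T = length lam}"
  proof clarsimp
    fix T assume T: "T \<in> SSYT lam"
    have "length xs \<le> length (concat T)" if "xs \<in> set T" for xs
      using that by (simp add: length_concat member_le_sum_list)
    then show "set T \<subseteq> {xs. set xs \<subseteq> (\<Union>x\<in>set T. set x) \<and> length xs \<le> length (concat T)} \<and> 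
      length T = length lam"
      using T by (auto simp: SSYT_def)
  qed
  show "finite {T. set T \<subseteq> ?R \<and> length T = length lam}"
    by (intro finite_lists_length_eq finite_lists_length_le) simp
qed

lemma complete_h_0: "complete_h 0 = 1"
proof -
  have "{is :: nat list. (sorted is \<and> length is = 0) \<and> mset is = M} = (if M = {#} then {[]} else {})" for M
    by auto
  then show ?thesis
    unfolding complete_h_def by transfer (auto simp: fun_eq_iff)
qed

lemma complete_h_hook: "complete_h_partition (hook n j) = complete_h (n - j) * complete_h 1 ^ j"
  by (cases "j = n") (auto simp: hook_def complete_h_partition_def complete_h_0)

lemma hook_partition: "j \<le> n \<Longrightarrow> hook n j \<turnstile>\<^sub>p n"
proof -
  have "sorted_wrt (\<ge>) (replicate j (1 :: nat))" for j
    by (simp add: sorted_wrt_iff_nth_less)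
  then show "j \<le> n \<Longrightarrow> hook n j \<turnstile>\<^sub>p n"
    by (auto simp: hook_def partition_of_def is_partition_def sum_list_replicate)
qed

lemma finite_partitions: "finite {lam. lam \<turnstile>\<^sub>p n}"
proof (rule finite_subset)
  have len: "0 \<notin> set lam \<Longrightarrow> length lam \<le> sum_list lam" for lam :: "nat list"
    by (induction lam) auto
  show "{lam. lam \<turnstile>\<^sub>p n} \<subseteq> {lam. set lam \<subseteq> {..n} \<and> length lam \<le> n}"
    using len by (auto simp: partition_of_def is_partition_def member_le_sum_list)
  show "finite {lam. set lam \<subseteq> {..n} \<and> length lam \<le> n}"
    by (rule finite_lists_length_le) simp
qed

lemma finite_Lam: "finite (Lam n k)"
  by (rule finite_subset[OF _ finite_partitions[of n]]) (auto simp: Lam_def)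

lemma diagram_Sigma: "diagram lam = (SIGMA i:{..<length lam}. {..<lam ! i})"
  by (auto simp: diagram_def)

lemma finite_diagram: "finite (diagram lam)"
  by (simp add: diagram_Sigma)

lemma card_diagram: "card (diagram lam) = sum_list lam"
  by (simp add: diagram_Sigma sum_list_sum_nth atLeast0LessThan)

lemma adds_box_size: "adds_box \<mu> lam \<Longrightarrow> sum_list lam = Suc (sum_list \<mu>)"
  using card_Diff_subset[OF finite_diagram, of \<mu> "diagram lam"]
    card_mono[OF finite_diagram, of "diagram \<mu>" lam]
  by (simp add: adds_box_def card_diagram)

lemma finite_vacillating_tableaux: "finite (vacillating_tableaux n k lam)"
proof (rule finite_subset)
  let ?P = "\<Union>m\<le>n. {\<mu>. \<mu> \<turnstile>\<^sub>p m}"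
  show "vacillating_tableaux n k lam \<subseteq> {t. set t \<subseteq> ?P \<and> length t = 2 * k + 1}"
  proof (clarify, intro conjI subsetI)
    fix t assume t: "t \<in> vacillating_tableaux n k lam"
    then show len: "length t = 2 * k + 1"
      by (simp add: vacillating_tableaux_def)
    have box: "adds_box (t ! (2 * j + 1)) (t ! (2 * j))" 
        "adds_box (t ! (2 * j + 1)) (t ! (2 * j + 2))" if "j < k" for j
      using t that by (auto simp: vacillating_tableaux_def)
    have ev: "sum_list (t ! (2 * j)) = n" if "j \<le> k" for j
      using that
    proof (induction j)
      case 0
      then show ?case using t by (simp add: vacillating_tableaux_def)
    next
      case (Suc j)
      then show ?case using box[of j] by (auto dest!: adds_box_size)
    qed
    fix \<mu> assume "\<mu> \<in> set t"
    then obtain i where i: "i < length t" "\<mu> = t ! i" by (auto simp: in_set_conv_nth)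
    have "sum_list \<mu> \<le> n"
    proof (cases "even i")
      case True
      then obtain j where "i = 2 * j" by auto
      then show ?thesis using ev[of j] i len by simp
    next
      case False
      then obtain j where "i = 2 * j + 1" by (auto elim: oddE)
      then show ?thesis using ev[of j] box(1)[of j] i len by (auto dest!: adds_box_size)
    qed
    moreover have "is_partition \<mu>"
      using t \<open>\<mu> \<in> set t\<close> by (simp add: vacillating_tableaux_def)
    ultimately show "\<mu> \<in> ?P" by (simp add: partition_of_def)
  qed
  show "finite {t. set t \<subseteq> ?P \<and> length t = 2 * k + 1}"
    by (intro finite_lists_length_eq finite_UN_I finite_partitions) simp
qed

end

theory Submission
  imports Defs
begin

text \<open>
  A step of a vacillating tableau removes a box and then adds one.  Write \<open>D\<close> and \<open>U\<close> for
  removing and adding a box in all possible ways.  If these acted on symmetric functions, \<open>U\<close>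
  would be multiplication by \<open>h\<^sub>1\<close> (the Pieri rule) and \<open>D\<close> the derivation adjoint to it, with
  \<open>D h\<^sub>n = h\<^bsub>n-1\<^esub>\<close>.  The left-hand side would then be \<open>(U D)\<^sup>k h\<^sub>n\<close>, and since
  \<open>D U - U D = 1\<close>, normal ordering gives \<open>(U D)\<^sup>k = \<Sum>j. S(k, j) U\<^sup>j D\<^sup>j\<close>, just as for the
  operator \<open>x d/dx\<close>; applied to \<open>h\<^sub>n\<close> this is the right-hand side.

  That \<open>D\<close> is well defined on symmetric functions rests on the linear independence of the Schur
  functions.  The proof below avoids this by transposing the operators: they act on arbitrary
  functions \<open>\<phi>\<close> from partitions to a commutative ring, where \<open>up_sum \<phi> \<mu>\<close> adds the values of \<open>\<phi>\<close>
  at the partitions covering \<open>\<mu>\<close>, and \<open>down_sum \<phi> \<lambda>\<close> those at the partitions covered by \<open>\<lambda>\<close>.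
  Transposition reverses the order of composition, so the sum of \<open>\<phi>\<close> over the end points of the
  tableaux starting at \<open>(n)\<close> is the value at \<open>(n)\<close> of the \<open>k\<close>-th iterate of
  \<open>down_sum \<circ> up_sum\<close> on \<open>\<phi>\<close> (\<open>sum_walks\<close>).

  Three facts carry the proof.  Young's lattice is differential (\<open>up_down_commute\<close>):
  \<open>up_sum \<circ> down_sum - down_sum \<circ> up_sum\<close> is the identity.  The function
  \<open>\<lambda> \<mapsto> s\<^sub>\<lambda>\<close> is an eigenfunction of \<open>up_sum\<close> with eigenvalue \<open>h\<^sub>1\<close> (\<open>schur_pieri\<close>); this
  is proved by Schensted's row insertion.  For any eigenfunction, the commutation relation turns
  the iterate into a sum over Stirling numbers (\<open>down_up_power_Stirling\<close>).  Finally, below a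
  single row there are only single rows, so the \<open>j\<close>-th power of \<open>down_sum\<close> at \<open>(n)\<close> yields
  \<open>s\<^bsub>(n-j)\<^esub> = h\<^bsub>n-j\<^esub>\<close>, and zero when \<open>j > n\<close>.
\<close>

section \<open>Covers in Young's lattice\<close>

definition up_covers :: "nat list \<Rightarrow> nat list set" where
  "up_covers \<mu> = {lam. is_partition lam \<and> adds_box \<mu> lam}"

definition down_covers :: "nat list \<Rightarrow> nat list set" where
  "down_covers lam = {\<mu>. is_partition \<mu> \<and> adds_box \<mu> lam}"

lemma is_partition_Nil [simp]: "is_partition []"
  by (simp add: is_partition_def)

lemma first_part_simps [simp]: "first_part [] = 0" "first_part (m # \<mu>) = m"
  by (simp_all add: first_part_def)

lemma is_partition_Cons:
  "is_partition (m # \<mu>) \<longleftrightarrow> m > 0 \<and> first_part \<mu> \<le> m \<and> is_partition \<mu>"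
  by (cases \<mu>) (auto simp: is_partition_def)

lemma diagram_Nil [simp]: "diagram [] = {}"
  by (simp add: diagram_def)

lemma diagram_Cons:
  "diagram (m # \<mu>) = {0} \<times> {..<m} \<union> map_prod Suc id ` diagram \<mu>"
proof (intro set_eqI iffI)
  fix p assume "p \<in> diagram (m # \<mu>)"
  then show "p \<in> {0} \<times> {..<m} \<union> map_prod Suc id ` diagram \<mu>"
    by (cases p; cases "fst p") (force simp: diagram_def)+
qed (auto simp: diagram_def)

text \<open>
  Covers are analysed by peeling off the first row.  The next lemmas reduce containment and the
  size of a skew diagram to the first rows and the tails; they end in the recursions
  \<open>adds_box_Cons_iff\<close>, \<open>up_covers_Cons\<close> and \<open>down_covers_Cons\<close>, on which every later
  induction over partitions runs.
\<close>

lemma diagram_Cons_subset: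
  "diagram (m # \<mu>) \<subseteq> diagram (l # lam) \<longleftrightarrow> m \<le> l \<and> diagram \<mu> \<subseteq> diagram lam"
proof -
  have "map_prod Suc id ` diagram \<mu> \<subseteq> map_prod Suc id ` diagram lam
      \<longleftrightarrow> diagram \<mu> \<subseteq> diagram lam"
    by (intro inj_image_subset_iff prod.inj_map) auto
  moreover have "{0 :: nat} \<times> {..<m} \<subseteq> {0} \<times> {..<l} \<longleftrightarrow> m \<le> l"
    by (cases "m = 0") (auto simp: times_subset_iff)
  moreover have "({0} \<times> {..<m} \<union> map_prod Suc id ` diagram \<mu> \<subseteq> {0} \<times> {..<l} \<union> map_prod Suc id ` diagram lam)
      \<longleftrightarrow> {0} \<times> {..<m} \<subseteq> {0 :: nat} \<times> {..<l} \<and> map_prod Suc id ` diagram \<mu> \<subseteq> map_prod Suc id ` diagram lam"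
    by blast
  ultimately show ?thesis
    unfolding diagram_Cons by metis
qed

lemma diagram_Cons_diff:
  "diagram (l # lam) - diagram (m # \<mu>) = {0} \<times> {m..<l} \<union> map_prod Suc id ` (diagram lam - diagram \<mu>)"
proof -
  have "map_prod Suc id ` (diagram lam - diagram \<mu>)
      = map_prod Suc id ` diagram lam - map_prod Suc id ` diagram \<mu>"
    by (intro image_set_diff prod.inj_map) auto
  then show ?thesis
    unfolding diagram_Cons by auto
qed

lemma card_diagram_Cons_diff:
  "card (diagram (l # lam) - diagram (m # \<mu>)) = (l - m) + card (diagram lam - diagram \<mu>)"
proof -
  have "inj (map_prod Suc id :: nat \<times> nat \<Rightarrow> _)"
    by (intro prod.inj_map) auto
  then have "card (map_prod Suc id ` (diagram lam - diagram \<mu>)) = card (diagram lam - diagram \<mu>)"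
    by (intro card_image) (auto intro: inj_on_subset)
  then show ?thesis
    unfolding diagram_Cons_diff
    by (subst card_Un_disjoint) (auto simp: finite_diagram card_cartesian_product)
qed

lemma diagram_inject:
  "is_partition \<mu> \<Longrightarrow> is_partition lam \<Longrightarrow> diagram \<mu> = diagram lam \<Longrightarrow> \<mu> = lam"
proof (induction \<mu> arbitrary: lam)
  case Nil
  then have "sum_list lam = 0"
    by (metis card.empty card_diagram diagram_Nil)
  with Nil show ?case
    by (cases lam) (auto simp: is_partition_Cons)
next
  case (Cons m \<mu>)
  show ?case
  proof (cases lam)
    case Nil
    then have "sum_list (m # \<mu>) = 0"
      using Cons.prems by (metis card.empty card_diagram diagram_Nil)
    with Cons.prems show ?thesis
      by (auto simp: is_partition_Cons)
  next
    case lam: (Cons l lam')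
    have "m \<le> l \<and> diagram \<mu> \<subseteq> diagram lam'" "l \<le> m \<and> diagram lam' \<subseteq> diagram \<mu>"
      using Cons.prems(3) unfolding lam by (metis diagram_Cons_subset order_refl)+
    with Cons lam show ?thesis
      by (auto simp: is_partition_Cons)
  qed
qed

lemma adds_box_Nil_iff: "is_partition lam \<Longrightarrow> adds_box [] lam \<longleftrightarrow> lam = [1]"
proof
  assume lam: "is_partition lam" "adds_box [] lam"
  from adds_box_size[OF this(2)] have size: "sum_list lam = 1" by simp
  show "lam = [1]"
  proof (cases lam)
    case Nil
    with size show ?thesis by simp
  next
    case (Cons l lam')
    with lam(1) have "l > 0" by (simp add: is_partition_Cons)
    moreover from Cons size have "l + sum_list lam' = 1" by simp
    ultimately have l: "l = 1" "sum_list lam' = 0" by linarith+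
    with Cons lam(1) have "lam' = []"
      by (cases lam') (auto simp: is_partition_Cons)
    with Cons l show ?thesis by simp
  qed
qed (simp add: adds_box_def diagram_Cons)

lemma not_adds_box_Nil: "\<not> adds_box \<mu> []"
  using adds_box_size by fastforce

lemma adds_box_Cons_iff:
  assumes "is_partition \<mu>" "is_partition lam"
  shows "adds_box (m # \<mu>) (l # lam) \<longleftrightarrow> l = Suc m \<and> lam = \<mu> \<or> l = m \<and> adds_box \<mu> lam"
proof
  assume *: "adds_box (m # \<mu>) (l # lam)"
  then have sub: "m \<le> l" "diagram \<mu> \<subseteq> diagram lam"
    and card: "(l - m) + card (diagram lam - diagram \<mu>) = 1"
    by (auto simp: adds_box_def diagram_Cons_subset card_diagram_Cons_diff)
  show "l = Suc m \<and> lam = \<mu> \<or> l = m \<and> adds_box \<mu> lam"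
  proof (cases "l = m")
    case True
    with sub card show ?thesis by (simp add: adds_box_def)
  next
    case False
    with sub card have l: "l = Suc m" and "card (diagram lam - diagram \<mu>) = 0"
      by linarith+
    then have "diagram lam - diagram \<mu> = {}"
      by (subst (asm) card_0_eq) (auto simp: finite_diagram)
    with sub have "diagram \<mu> = diagram lam" by auto
    with assms l show ?thesis using diagram_inject by blast
  qed
qed (auto simp: adds_box_def diagram_Cons_subset card_diagram_Cons_diff)

lemma up_covers_Nil: "up_covers [] = {[1]}"
  by (auto simp: up_covers_def adds_box_Nil_iff is_partition_Cons)

lemma down_covers_Nil: "down_covers [] = {}"
  by (auto simp: down_covers_def not_adds_box_Nil)

lemma up_covers_Cons:
  assumes "is_partition (m # \<mu>)"
  shows "up_covers (m # \<mu>)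
       = insert (Suc m # \<mu>) (Cons m ` {lam \<in> up_covers \<mu>. first_part lam \<le> m})"
proof -
  have "lam \<in> up_covers (m # \<mu>) \<longleftrightarrow>
      lam \<in> insert (Suc m # \<mu>) (Cons m ` {lam \<in> up_covers \<mu>. first_part lam \<le> m})" for lam
  proof (cases lam)
    case Nil
    then show ?thesis by (auto simp: up_covers_def not_adds_box_Nil)
  next
    case (Cons l lam')
    with assms show ?thesis
      by (auto simp: up_covers_def is_partition_Cons adds_box_Cons_iff)
  qed
  then show ?thesis by blast
qed

text \<open>
  Removing a box from the row of \<open>(1)\<close> leaves no row at all, whereas lists representing partitions
  have no zero entries.  This variant of \<^const>\<open>Cons\<close> drops an empty first row, which lets
  \<open>(m - 1, \<mu>)\<close> be written uniformly; for \<open>m = 0\<close> the tail of a partition is empty anyway.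
\<close>

definition row_cons :: "nat \<Rightarrow> nat list \<Rightarrow> nat list" where
  "row_cons m \<mu> = (if m = 0 then [] else m # \<mu>)"

lemma row_cons_simps [simp]: "row_cons 0 \<mu> = []" "m > 0 \<Longrightarrow> row_cons m \<mu> = m # \<mu>"
  by (simp_all add: row_cons_def)

lemma down_covers_Cons:
  assumes "is_partition (m # \<mu>)"
  shows "down_covers (m # \<mu>)
       = (if first_part \<mu> < m then {row_cons (m - 1) \<mu>} else {}) \<union> Cons m ` down_covers \<mu>"
proof -
  have "\<nu> \<in> down_covers (m # \<mu>) \<longleftrightarrow>
      \<nu> \<in> (if first_part \<mu> < m then {row_cons (m - 1) \<mu>} else {}) \<union> Cons m ` down_covers \<mu>" for \<nu>
  proof (cases \<nu>)
    case Nil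
    then show ?thesis
      using assms by (cases \<mu>)
        (auto simp: down_covers_def is_partition_Cons adds_box_Nil_iff row_cons_def)
  next
    case (Cons l \<nu>')
    \<comment> \<open>Shrinking the tail keeps the list weakly decreasing.\<close>
    have "first_part \<nu>' \<le> m" if "is_partition \<nu>'" "adds_box \<nu>' \<mu>"
      using that assms by (cases \<nu>'; cases \<mu>)
        (auto simp: is_partition_Cons adds_box_Cons_iff not_adds_box_Nil)
    with Cons assms show ?thesis
      by (auto simp: down_covers_def is_partition_Cons adds_box_Cons_iff row_cons_def)
  qed
  then show ?thesis by blast
qed

lemma finite_up_covers: "finite (up_covers \<mu>)"
  by (rule finite_subset[OF _ finite_partitions[of "Suc (sum_list \<mu>)"]])
    (auto simp: up_covers_def partition_of_def dest: adds_box_size)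

lemma finite_down_covers: "finite (down_covers lam)"
  by (rule finite_subset[OF _ finite_partitions[of "sum_list lam - 1"]])
    (auto simp: down_covers_def partition_of_def dest: adds_box_size)

section \<open>The commutation relation\<close>

definition up_sum :: "(nat list \<Rightarrow> 'a) \<Rightarrow> nat list \<Rightarrow> 'a :: comm_ring_1" where
  "up_sum \<phi> \<mu> = (\<Sum>lam \<in> up_covers \<mu>. \<phi> lam)"

definition down_sum :: "(nat list \<Rightarrow> 'a) \<Rightarrow> nat list \<Rightarrow> 'a :: comm_ring_1" where
  "down_sum \<phi> lam = (\<Sum>\<mu> \<in> down_covers lam. \<phi> \<mu>)"

lemma up_sum_cong:
  "(\<And>lam. is_partition lam \<Longrightarrow> \<phi> lam = \<psi> lam) \<Longrightarrow> up_sum \<phi> \<mu> = up_sum \<psi> \<mu>"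
  unfolding up_sum_def by (intro sum.cong) (auto simp: up_covers_def)

lemma down_sum_cong:
  "(\<And>\<mu>. is_partition \<mu> \<Longrightarrow> \<phi> \<mu> = \<psi> \<mu>) \<Longrightarrow> down_sum \<phi> lam = down_sum \<psi> lam"
  unfolding down_sum_def by (intro sum.cong) (auto simp: down_covers_def)

lemma up_sum_Cons:
  assumes "is_partition (m # \<mu>)"
  shows "up_sum \<phi> (m # \<mu>)
       = \<phi> (Suc m # \<mu>) + up_sum (\<lambda>lam. if first_part lam \<le> m then \<phi> (m # lam) else 0) \<mu>"
proof -
  have "up_sum \<phi> (m # \<mu>)
      = \<phi> (Suc m # \<mu>) + (\<Sum>lam | lam \<in> up_covers \<mu> \<and> first_part lam \<le> m. \<phi> (m # lam))"
    unfolding up_sum_def up_covers_Cons[OF assms]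
    by (subst sum.insert) (auto simp: finite_up_covers sum.reindex)
  then show ?thesis
    by (simp add: up_sum_def sum.If_cases[OF finite_up_covers] Int_def)
qed

lemma up_sum_row_cons:
  assumes "is_partition \<mu>" "first_part \<mu> \<le> m"
  shows "up_sum \<phi> (row_cons m \<mu>)
       = \<phi> (Suc m # \<mu>) + up_sum (\<lambda>lam. if first_part lam \<le> m then \<phi> (row_cons m lam) else 0) \<mu>"
proof (cases "m = 0")
  case True
  with assms have "\<mu> = []" by (cases \<mu>) (auto simp: is_partition_Cons)
  with True show ?thesis by (simp add: up_sum_def up_covers_Nil)
next
  case False
  with assms have "is_partition (m # \<mu>)" by (simp add: is_partition_Cons)
  from up_sum_Cons[OF this, of \<phi>] False show ?thesis by (simp cong: if_cong)
qed

lemma down_sum_Cons: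
  assumes "is_partition (m # \<mu>)"
  shows "down_sum \<phi> (m # \<mu>)
       = (if first_part \<mu> < m then \<phi> (row_cons (m - 1) \<mu>) else 0) + down_sum (\<lambda>\<nu>. \<phi> (m # \<nu>)) \<mu>"
proof -
  have "row_cons (m - 1) \<mu> \<notin> Cons m ` down_covers \<mu>"
    using assms by (auto simp: row_cons_def is_partition_Cons split: if_splits)
  then show ?thesis
    unfolding down_sum_def down_covers_Cons[OF assms]
    by (simp add: finite_down_covers sum.reindex)
qed

lemma up_sum_add: "up_sum (\<lambda>\<mu>. \<phi> \<mu> + \<psi> \<mu>) \<nu> = up_sum \<phi> \<nu> + up_sum \<psi> \<nu>"
  by (simp add: up_sum_def sum.distrib)

lemma down_sum_add: "down_sum (\<lambda>\<mu>. \<phi> \<mu> + \<psi> \<mu>) \<nu> = down_sum \<phi> \<nu> + down_sum \<psi> \<nu>"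
  by (simp add: down_sum_def sum.distrib)

lemma down_sum_mult: "down_sum (\<lambda>\<mu>. c * \<phi> \<mu>) \<nu> = c * down_sum \<phi> \<nu>"
  by (simp add: down_sum_def sum_distrib_left)

lemma first_part_down: "is_partition lam \<Longrightarrow> \<mu> \<in> down_covers lam \<Longrightarrow>
    first_part \<mu> \<le> first_part lam \<and> first_part lam \<le> Suc (first_part \<mu>)"
  by (cases lam; cases \<mu>)
    (auto simp: down_covers_def is_partition_Cons adds_box_Cons_iff adds_box_Nil_iff not_adds_box_Nil)

text \<open>
  The up-covers of \<open>(m, \<mu>)\<close> only involve tails whose first part is at most \<open>m\<close>, whereas the
  induction hypothesis of \<open>up_down_commute\<close> ranges over all covers of \<open>\<mu>\<close>.  The hypothesis is
  therefore applied to \<open>\<phi>\<close> cut off at first part \<open>m\<close>.  Moving the cut-off outwards costs one term: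
  the only cover of \<open>\<mu>\<close> exceeding the bound is the one that lengthens a first row of length \<open>m\<close>,
  and the only partition within the bound below it is \<open>\<mu>\<close> itself.
\<close>

lemma bounded_up_down:
  assumes "is_partition \<mu>" "first_part \<mu> \<le> m"
  shows "up_sum (down_sum (\<lambda>\<nu>. if first_part \<nu> \<le> m then \<phi> \<nu> else 0)) \<mu>
       = up_sum (\<lambda>lam. if first_part lam \<le> m then down_sum \<phi> lam else 0) \<mu>
         + (if first_part \<mu> = m then \<phi> \<mu> else 0)"
proof -
  let ?\<psi> = "\<lambda>\<nu>. if first_part \<nu> \<le> m then \<phi> \<nu> else 0"
  have low: "down_sum ?\<psi> lam = down_sum \<phi> lam" if "is_partition lam" "first_part lam \<le> m" for lam
    unfolding down_sum_def using first_part_down[OF that(1)] that(2)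
    by (intro sum.cong) (auto intro: order_trans)
  show ?thesis
  proof (cases \<mu>)
    case Nil
    then show ?thesis
      using low[of "[1]"]
      by (auto simp: up_sum_def up_covers_Nil down_sum_def down_covers_Cons is_partition_Cons down_covers_Nil)
  next
    case (Cons a \<mu>')
    have high: "down_sum ?\<psi> (Suc a # \<mu>') = (if a = m then \<phi> \<mu> else down_sum \<phi> (Suc a # \<mu>'))"
    proof (cases "a = m")
      case True
      have "is_partition (Suc a # \<mu>')" "first_part \<mu>' < Suc a" "a > 0"
        using assms Cons by (auto simp: is_partition_Cons)
      then show ?thesis
        using True Cons by (simp add: down_sum_Cons) (simp add: down_sum_def)
    next
      case False
      with assms Cons have "is_partition (Suc a # \<mu>')" "Suc a \<le> m"
        by (auto simp: is_partition_Cons)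
      with False low show ?thesis by simp
    qed
    have tail: "up_sum (\<lambda>lam. if first_part lam \<le> a then down_sum ?\<psi> (a # lam) else 0) \<mu>'
        = up_sum (\<lambda>lam. if first_part lam \<le> a then
            (if first_part (a # lam) \<le> m then down_sum \<phi> (a # lam) else 0) else 0) \<mu>'"
      using assms Cons by (intro up_sum_cong) (auto simp: is_partition_Cons intro!: low)
    show ?thesis
      using assms high tail unfolding Cons by (auto simp: up_sum_Cons)
  qed
qed

text \<open>
  Changing the first row and changing the tail commute, except for two effects that involve the
  first row.  Adding a box to the first row and removing it again always returns \<open>(m, \<mu>)\<close>, while
  removing and then adding it back is possible only if \<open>\<mu>\<^sub>1 < m\<close>; and if \<open>\<mu>\<^sub>1 = m\<close>,
  the bound on the tail loses one term by \<open>bounded_up_down\<close>.  Together with the term \<open>\<phi>\<close> that the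
  tail contributes by induction, exactly one copy of \<open>\<phi> (m, \<mu>)\<close> remains.
\<close>

lemma up_down_commute:
  assumes "is_partition \<mu>"
  shows "up_sum (down_sum \<phi>) \<mu> = down_sum (up_sum \<phi>) \<mu> + \<phi> \<mu>"
  using assms
proof (induction \<mu> arbitrary: \<phi>)
  case Nil
  then show ?case
    by (simp add: up_sum_def down_sum_def up_covers_Nil down_covers_Nil down_covers_Cons is_partition_Cons)
next
  case (Cons m \<mu>)
  note part = \<open>is_partition (m # \<mu>)\<close>
  then have \<mu>: "is_partition \<mu>" "first_part \<mu> \<le> m" "m > 0"
    by (auto simp: is_partition_Cons)
  let ?\<psi> = "\<lambda>\<nu>. if first_part \<nu> \<le> m then \<phi> (m # \<nu>) else 0"
  \<comment> \<open>The terms in which a box moves from the first row to the tail.\<close>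
  let ?low = "up_sum (\<lambda>lam. if first_part lam < m then \<phi> (row_cons (m - 1) lam) else 0) \<mu>"
  have A: "up_sum (down_sum \<phi>) (m # \<mu>)
      = \<phi> (m # \<mu>) + down_sum (\<lambda>\<nu>. \<phi> (Suc m # \<nu>)) \<mu> + ?low
        + up_sum (\<lambda>lam. if first_part lam \<le> m then down_sum (\<lambda>\<nu>. \<phi> (m # \<nu>)) lam else 0) \<mu>"
  proof -
    have "up_sum (\<lambda>lam. if first_part lam \<le> m then down_sum \<phi> (m # lam) else 0) \<mu>
        = up_sum (\<lambda>lam. (if first_part lam < m then \<phi> (row_cons (m - 1) lam) else 0)
            + (if first_part lam \<le> m then down_sum (\<lambda>\<nu>. \<phi> (m # \<nu>)) lam else 0)) \<mu>"
      using \<mu> by (intro up_sum_cong) (auto simp: down_sum_Cons is_partition_Cons)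
    moreover have "is_partition (Suc m # \<mu>)"
      using \<mu> by (simp add: is_partition_Cons)
    ultimately show ?thesis
      using \<mu> part by (simp add: up_sum_Cons down_sum_Cons up_sum_add)
  qed
  have B: "down_sum (up_sum \<phi>) (m # \<mu>)
      = (if first_part \<mu> < m then \<phi> (m # \<mu>) + ?low else 0)
        + down_sum (\<lambda>\<nu>. \<phi> (Suc m # \<nu>)) \<mu> + down_sum (up_sum ?\<psi>) \<mu>"
  proof -
    have "down_sum (\<lambda>\<nu>. up_sum \<phi> (m # \<nu>)) \<mu>
        = down_sum (\<lambda>\<nu>. \<phi> (Suc m # \<nu>) + up_sum ?\<psi> \<nu>) \<mu>"
      unfolding down_sum_def
    proof (rule sum.cong[OF refl])
      fix \<nu> assume "\<nu> \<in> down_covers \<mu>"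
      with first_part_down[OF \<mu>(1) this] \<mu> have "is_partition (m # \<nu>)"
        by (auto simp: down_covers_def is_partition_Cons)
      then show "up_sum \<phi> (m # \<nu>) = \<phi> (Suc m # \<nu>) + up_sum ?\<psi> \<nu>"
        by (rule up_sum_Cons)
    qed
    moreover have "up_sum \<phi> (row_cons (m - 1) \<mu>) = \<phi> (m # \<mu>) + ?low" if "first_part \<mu> < m"
    proof -
      have "(first_part lam \<le> m - 1) = (first_part lam < m)" for lam
        using \<mu>(3) by linarith
      then show ?thesis
        using that \<mu> by (subst up_sum_row_cons) auto
    qed
    ultimately show ?thesis
      using part by (simp add: down_sum_Cons down_sum_add)
  qed
  \<comment> \<open>If the first two rows have equal length, no box can leave the first row.\<close>
  have low0: "?low = 0" if "\<not> first_part \<mu> < m"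
  proof -
    have "\<not> first_part lam < m" if lam: "lam \<in> up_covers \<mu>" for lam
      using first_part_down[of lam \<mu>] lam \<open>\<not> first_part \<mu> < m\<close> \<mu>(1)
      by (auto simp: up_covers_def down_covers_def)
    then show ?thesis by (simp add: up_sum_def)
  qed
  \<comment> \<open>Both moves happen in the tail: the induction hypothesis with the bound on the tail.\<close>
  have C: "up_sum (\<lambda>lam. if first_part lam \<le> m then down_sum (\<lambda>\<nu>. \<phi> (m # \<nu>)) lam else 0) \<mu>
      + (if first_part \<mu> = m then \<phi> (m # \<mu>) else 0) = down_sum (up_sum ?\<psi>) \<mu> + \<phi> (m # \<mu>)"
    using bounded_up_down[OF \<mu>(1,2), of "\<lambda>\<nu>. \<phi> (m # \<nu>)"] Cons.IH[OF \<mu>(1), of ?\<psi>] \<mu>(2) by simp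
  show ?case
  proof (cases "first_part \<mu> < m")
    case True
    with A B C show ?thesis by (simp add: algebra_simps)
  next
    case False
    with \<mu>(2) A B C low0 show ?thesis by (simp add: algebra_simps)
  qed
qed

section \<open>Normal ordering\<close>

text \<open>
  Commuting \<open>up_sum\<close> past \<open>j\<close> copies of \<open>down_sum\<close> gives \<open>j\<close> correction terms by
  \<open>up_down_commute\<close>, as in \<open>d/dx x\<^sup>j = x\<^sup>j d/dx + j x\<^bsup>j-1\<^esup>\<close>.  At \<open>j = 0\<close> the truncated exponent is
  harmless because its coefficient vanishes.
\<close>

lemma up_sum_down_power:
  assumes eigen: "\<And>\<mu>. is_partition \<mu> \<Longrightarrow> up_sum \<phi> \<mu> = c * \<phi> \<mu>" and "is_partition \<mu>"
  shows "up_sum ((down_sum ^^ j) \<phi>) \<mu>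
       = c * (down_sum ^^ j) \<phi> \<mu> + of_nat j * (down_sum ^^ (j - 1)) \<phi> \<mu>"
  using assms(2)
proof (induction j arbitrary: \<mu>)
  case 0
  then show ?case by (simp add: eigen)
next
  case (Suc j)
  have "up_sum ((down_sum ^^ Suc j) \<phi>) \<mu>
      = down_sum (up_sum ((down_sum ^^ j) \<phi>)) \<mu> + (down_sum ^^ j) \<phi> \<mu>"
    using Suc.prems by (simp add: up_down_commute)
  also have "down_sum (up_sum ((down_sum ^^ j) \<phi>)) \<mu>
      = down_sum (\<lambda>\<mu>. c * (down_sum ^^ j) \<phi> \<mu> + of_nat j * (down_sum ^^ (j - 1)) \<phi> \<mu>) \<mu>"
    by (intro down_sum_cong Suc.IH)
  also have "\<dots> = c * (down_sum ^^ Suc j) \<phi> \<mu> + of_nat j * (down_sum ^^ j) \<phi> \<mu>"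
    by (cases j) (simp_all add: down_sum_add down_sum_mult)
  finally show ?case by (simp add: algebra_simps)
qed

lemma down_sum_sum: "down_sum (\<lambda>\<mu>. \<Sum>i\<in>I. f i \<mu>) \<nu> = (\<Sum>i\<in>I. down_sum (f i) \<nu>)"
  unfolding down_sum_def by (rule sum.swap)

lemma up_sum_sum: "up_sum (\<lambda>\<mu>. \<Sum>i\<in>I. f i \<mu>) \<nu> = (\<Sum>i\<in>I. up_sum (f i) \<nu>)"
  unfolding up_sum_def by (rule sum.swap)

lemma up_sum_mult: "up_sum (\<lambda>\<mu>. c * \<phi> \<mu>) \<nu> = c * up_sum \<phi> \<nu>"
  by (simp add: up_sum_def sum_distrib_left)

text \<open>
  Applying \<open>down_sum \<circ> up_sum\<close> to \<open>c\<^sup>j D\<^sup>j \<phi>\<close>, where \<open>D = down_sum\<close>, gives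
  \<open>c\<^bsup>j+1\<^esup> D\<^bsup>j+1\<^esup> \<phi> + j c\<^sup>j D\<^sup>j \<phi>\<close>, so the coefficients obey the recurrence
  \<open>S(k + 1, j) = S(k, j - 1) + j S(k, j)\<close>.
\<close>

lemma down_up_power_Stirling:
  assumes eigen: "\<And>\<mu>. is_partition \<mu> \<Longrightarrow> up_sum \<phi> \<mu> = c * \<phi> \<mu>" and "is_partition \<mu>"
  shows "((\<lambda>\<psi>. down_sum (up_sum \<psi>)) ^^ k) \<phi> \<mu>
       = (\<Sum>j\<le>k. of_nat (Stirling k j) * c ^ j * (down_sum ^^ j) \<phi> \<mu>)"
  using assms(2)
proof (induction k arbitrary: \<mu>)
  case 0
  then show ?case by simp
next
  case (Suc k)
  let ?d = "\<lambda>j. (down_sum ^^ j) \<phi> \<mu>"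
  have "((\<lambda>\<psi>. down_sum (up_sum \<psi>)) ^^ Suc k) \<phi> \<mu>
      = down_sum (up_sum (\<lambda>\<mu>. \<Sum>j\<le>k. of_nat (Stirling k j) * c ^ j * (down_sum ^^ j) \<phi> \<mu>)) \<mu>"
    by (simp, intro down_sum_cong up_sum_cong Suc.IH)
  also have "\<dots> = down_sum (\<lambda>\<mu>. \<Sum>j\<le>k. of_nat (Stirling k j) * c ^ j *
      (c * (down_sum ^^ j) \<phi> \<mu> + of_nat j * (down_sum ^^ (j - 1)) \<phi> \<mu>)) \<mu>"
    by (intro down_sum_cong) (simp add: up_sum_sum up_sum_mult up_sum_down_power[OF eigen])
  also have "\<dots> = (\<Sum>j\<le>k. of_nat (Stirling k j) * c ^ j * (c * ?d (Suc j) + of_nat j * ?d j))"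
    unfolding down_sum_sum down_sum_mult down_sum_add
  proof (intro sum.cong refl)
    fix j
    have "of_nat j * down_sum ((down_sum ^^ (j - 1)) \<phi>) \<mu> = of_nat j * ?d j"
      by (cases j) simp_all
    then show "of_nat (Stirling k j) * c ^ j * (c * down_sum ((down_sum ^^ j) \<phi>) \<mu> +
        of_nat j * down_sum ((down_sum ^^ (j - 1)) \<phi>) \<mu>)
      = of_nat (Stirling k j) * c ^ j * (c * ?d (Suc j) + of_nat j * ?d j)"
      by simp
  qed
  also have "\<dots> = (\<Sum>j\<le>k. of_nat (Stirling k j) * c ^ Suc j * ?d (Suc j))
      + (\<Sum>j\<le>k. of_nat (j * Stirling k j) * c ^ j * ?d j)"
    by (simp add: sum.distrib algebra_simps)
  \<comment> \<open>The extra summand is zero, as \<open>S(k, k + 1) = 0\<close>; it aligns the index ranges of the two sums.\<close>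
  also have "(\<Sum>j\<le>k. of_nat (j * Stirling k j) * c ^ j * ?d j)
      = (\<Sum>j\<le>Suc k. of_nat (j * Stirling k j) * c ^ j * ?d j)"
    by simp
  also have "\<dots> = (\<Sum>j\<le>k. of_nat (Suc j * Stirling k (Suc j)) * c ^ Suc j * ?d (Suc j))"
    by (subst sum.atMost_Suc_shift) simp
  also have "(\<Sum>j\<le>k. of_nat (Stirling k j) * c ^ Suc j * ?d (Suc j)) + \<dots>
      = (\<Sum>j\<le>k. of_nat (Stirling (Suc k) (Suc j)) * c ^ Suc j * ?d (Suc j))"
    by (simp add: sum.distrib[symmetric] algebra_simps)
  also have "\<dots> = (\<Sum>j\<le>Suc k. of_nat (Stirling (Suc k) j) * c ^ j * ?d j)"
    by (subst sum.atMost_Suc_shift) simp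
  finally show ?case .
qed

lemma down_power_row:
  "(down_sum ^^ j) \<phi> (row_cons n []) = (if j \<le> n then \<phi> (row_cons (n - j) []) else 0)"
proof (induction j arbitrary: n)
  case 0
  then show ?case by simp
next
  case (Suc j)
  show ?case
  proof (cases n)
    case 0
    then show ?thesis by (simp add: down_sum_def down_covers_Nil)
  next
    case n: (Suc m)
    have "down_covers [Suc m] = {row_cons m []}"
      by (simp add: down_covers_Cons is_partition_Cons down_covers_Nil)
    then show ?thesis
      using Suc n by (simp add: down_sum_def)
  qed
qed

section \<open>Sums over vacillating tableaux\<close>

text \<open>
  Vacillating tableaux with an arbitrary initial partition: dropping the first step of a tableau
  changes its initial partition, so the recursion on \<open>k\<close> needs this generality.
\<close>

definition walks :: "nat \<Rightarrow> nat list \<Rightarrow> nat list \<Rightarrow> nat list list set" where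
  "walks k \<sigma> lam =
    {t. length t = 2 * k + 1 \<and> (\<forall>\<mu> \<in> set t. is_partition \<mu>) \<and>
        t ! 0 = \<sigma> \<and> t ! (2 * k) = lam \<and>
        (\<forall>j < k. adds_box (t ! (2 * j + 1)) (t ! (2 * j)) \<and>
                 adds_box (t ! (2 * j + 1)) (t ! (2 * j + 2)))}"

lemma walks_start: "t \<in> walks k \<sigma> lam \<Longrightarrow> t ! 0 = \<sigma>"
  by (simp add: walks_def)

lemma walks_0: "is_partition \<sigma> \<Longrightarrow> walks 0 \<sigma> lam = (if lam = \<sigma> then {[\<sigma>]} else {})"
  by (auto simp: walks_def length_Suc_conv)

lemma walks_Suc:
  assumes "is_partition \<sigma>"
  shows "walks (Suc k) \<sigma> lam
       = (\<Union>\<nu>\<in>down_covers \<sigma>. \<Union>\<rho>\<in>up_covers \<nu>. (\<lambda>t. \<sigma> # \<nu> # t) ` walks k \<rho> lam)"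
proof (intro set_eqI iffI)
  fix t assume t: "t \<in> walks (Suc k) \<sigma> lam"
  then have "length t = Suc (Suc (2 * k + 1))" and "t ! 0 = \<sigma>"
    by (auto simp: walks_def)
  then obtain \<nu> t' where t': "t = \<sigma> # \<nu> # t'" "length t' = 2 * k + 1"
    by (metis length_Suc_conv nth_Cons_0)
  have box: "adds_box (t ! (2 * j + 1)) (t ! (2 * j))" "adds_box (t ! (2 * j + 1)) (t ! (2 * j + 2))"
    if "j < Suc k" for j
    using t that by (auto simp: walks_def)
  have part: "is_partition \<nu>" "\<forall>\<mu>\<in>set t'. is_partition \<mu>"
    using t t' by (auto simp: walks_def)
  have "t' \<in> walks k (t' ! 0) lam"
    unfolding walks_def
  proof (intro CollectI conjI allI impI refl t' part)
    show "t' ! (2 * k) = lam" using t t' by (simp add: walks_def)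
    fix j assume "j < k"
    then show "adds_box (t' ! (2 * j + 1)) (t' ! (2 * j))" "adds_box (t' ! (2 * j + 1)) (t' ! (2 * j + 2))"
      using box[of "Suc j"] t' by auto
  qed
  moreover have "is_partition (t' ! 0)"
    using part t' by simp
  moreover have "adds_box \<nu> \<sigma>" "adds_box \<nu> (t' ! 0)"
    using box[of 0] t' by auto
  ultimately show "t \<in> (\<Union>\<nu>\<in>down_covers \<sigma>. \<Union>\<rho>\<in>up_covers \<nu>. (\<lambda>t. \<sigma> # \<nu> # t) ` walks k \<rho> lam)"
    using t'(1) part(1) by (simp only: UN_iff down_covers_def up_covers_def mem_Collect_eq) blast
next
  fix t assume "t \<in> (\<Union>\<nu>\<in>down_covers \<sigma>. \<Union>\<rho>\<in>up_covers \<nu>. (\<lambda>t. \<sigma> # \<nu> # t) ` walks k \<rho> lam)"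
  then obtain \<nu> \<rho> t' where *: "is_partition \<nu>" "adds_box \<nu> \<sigma>" "adds_box \<nu> \<rho>"
      "t' \<in> walks k \<rho> lam" "t = \<sigma> # \<nu> # t'"
    by (auto simp: down_covers_def up_covers_def)
  have "adds_box (t ! (2 * j + 1)) (t ! (2 * j)) \<and> adds_box (t ! (2 * j + 1)) (t ! (2 * j + 2))"
    if "j < Suc k" for j
    using * that by (cases j) (auto simp: walks_def)
  with * assms show "t \<in> walks (Suc k) \<sigma> lam"
    by (auto simp: walks_def)
qed

lemma walks_finite: "is_partition \<sigma> \<Longrightarrow> finite (walks k \<sigma> lam)"
proof (induction k arbitrary: \<sigma>)
  case (Suc k)
  then show ?case
    by (simp add: walks_Suc)
      (intro finite_UN_I finite_imageI finite_down_covers finite_up_covers, simp add: up_covers_def)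
qed (simp add: walks_0)

lemma card_walks_Suc:
  assumes "is_partition \<sigma>"
  shows "card (walks (Suc k) \<sigma> lam)
       = (\<Sum>\<nu>\<in>down_covers \<sigma>. \<Sum>\<rho>\<in>up_covers \<nu>. card (walks k \<rho> lam))"
proof -
  have fin: "finite (walks k \<rho> lam)" if "\<rho> \<in> up_covers \<nu>" for \<nu> \<rho>
    using that by (simp add: up_covers_def walks_finite)
  have "card (\<Union>\<rho>\<in>up_covers \<nu>. (\<lambda>t. \<sigma> # \<nu> # t) ` walks k \<rho> lam)
      = (\<Sum>\<rho>\<in>up_covers \<nu>. card (walks k \<rho> lam))" for \<nu>
    by (subst card_UN_disjoint)
      (auto simp: finite_up_covers fin card_image inj_on_def dest: walks_start)
  then show ?thesis
    unfolding walks_Suc[OF assms]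
    by (subst card_UN_disjoint) (auto simp: finite_down_covers finite_up_covers fin)
qed

text \<open>
  Each of the \<open>k\<close> removals lowers the first part by at most one.  This is why summing over
  \<^const>\<open>Lam\<close> loses no tableau.
\<close>

lemma walks_shape:
  assumes "is_partition \<sigma>" "walks k \<sigma> lam \<noteq> {}"
  shows "lam \<in> {lam. lam \<turnstile>\<^sub>p sum_list \<sigma>} \<and> first_part \<sigma> \<le> first_part lam + k"
  using assms
proof (induction k arbitrary: \<sigma>)
  case 0
  then show ?case by (auto simp: walks_0 partition_of_def split: if_splits)
next
  case (Suc k)
  then obtain \<nu> \<rho> where *: "\<nu> \<in> down_covers \<sigma>" "\<rho> \<in> up_covers \<nu>" "walks k \<rho> lam \<noteq> {}"
    by (auto simp: walks_Suc)
  then have "is_partition \<rho>" "\<nu> \<in> down_covers \<rho>" "sum_list \<rho> = sum_list \<sigma>"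
    by (auto simp: up_covers_def down_covers_def dest!: adds_box_size)
  with Suc.IH[of \<rho>] * first_part_down[of \<rho> \<nu>] first_part_down[of \<sigma> \<nu>] Suc.prems
  show ?case by auto
qed

text \<open>
  Splitting off the first step of a walk corresponds to the outermost application of
  \<open>down_sum \<circ> up_sum\<close>.
\<close>

lemma sum_walks:
  assumes "\<sigma> \<turnstile>\<^sub>p n"
  shows "(\<Sum>lam | lam \<turnstile>\<^sub>p n. of_nat (card (walks k \<sigma> lam)) * \<phi> lam)
       = ((\<lambda>\<psi>. down_sum (up_sum \<psi>)) ^^ k) \<phi> \<sigma>"
  using assms
proof (induction k arbitrary: \<sigma>)
  case 0
  then have "of_nat (card (walks 0 \<sigma> lam)) * \<phi> lam = (if lam = \<sigma> then \<phi> lam else 0)" for lam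
    by (simp add: walks_0 partition_of_def)
  with 0 show ?case by (simp add: finite_partitions)
next
  case (Suc k)
  then have \<sigma>: "is_partition \<sigma>" by (simp add: partition_of_def)
  have \<rho>: "\<rho> \<turnstile>\<^sub>p n" if "\<nu> \<in> down_covers \<sigma>" "\<rho> \<in> up_covers \<nu>" for \<nu> \<rho>
    using that Suc.prems by (auto simp: up_covers_def down_covers_def partition_of_def dest!: adds_box_size)
  have "(\<Sum>lam | lam \<turnstile>\<^sub>p n. of_nat (card (walks (Suc k) \<sigma> lam)) * \<phi> lam)
      = (\<Sum>lam | lam \<turnstile>\<^sub>p n. \<Sum>\<nu>\<in>down_covers \<sigma>. \<Sum>\<rho>\<in>up_covers \<nu>. of_nat (card (walks k \<rho> lam)) * \<phi> lam)"
    by (simp add: card_walks_Suc[OF \<sigma>] sum_distrib_right)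
  also have "\<dots> = (\<Sum>\<nu>\<in>down_covers \<sigma>. \<Sum>lam | lam \<turnstile>\<^sub>p n. \<Sum>\<rho>\<in>up_covers \<nu>. of_nat (card (walks k \<rho> lam)) * \<phi> lam)"
    by (rule sum.swap)
  also have "\<dots> = (\<Sum>\<nu>\<in>down_covers \<sigma>. \<Sum>\<rho>\<in>up_covers \<nu>. \<Sum>lam | lam \<turnstile>\<^sub>p n. of_nat (card (walks k \<rho> lam)) * \<phi> lam)"
    by (intro sum.cong refl sum.swap)
  also have "\<dots> = (\<Sum>\<nu>\<in>down_covers \<sigma>. \<Sum>\<rho>\<in>up_covers \<nu>. ((\<lambda>\<psi>. down_sum (up_sum \<psi>)) ^^ k) \<phi> \<rho>)"
    using Suc.IH \<rho> by (intro sum.cong refl) simp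
  also have "\<dots> = ((\<lambda>\<psi>. down_sum (up_sum \<psi>)) ^^ Suc k) \<phi> \<sigma>"
    by (simp add: down_sum_def up_sum_def)
  finally show ?case .
qed

section \<open>Row insertion\<close>

definition first_row :: "nat list list \<Rightarrow> nat list" where
  "first_row T = (case T of [] \<Rightarrow> [] | r # _ \<Rightarrow> r)"

lemma first_row_simps [simp]: "first_row [] = []" "first_row (r # T) = r"
  by (simp_all add: first_row_def)

definition column_strict :: "nat list \<Rightarrow> nat list \<Rightarrow> bool" where
  "column_strict r r' \<longleftrightarrow> (\<forall>j. j < length r \<and> j < length r' \<longrightarrow> r ! j < r' ! j)"

lemma all_nat_split: "(\<forall>i. P i) \<longleftrightarrow> P 0 \<and> (\<forall>i. P (Suc i))"
  by (metis not0_implies_Suc)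

lemma SSYT_Nil: "SSYT [] = {[]}"
  by (auto simp: SSYT_def)

text \<open>
  Only adjacent rows are compared, so a tableau is checked row by row from the bottom up.
\<close>

lemma Cons_in_SSYT_iff:
  "r # T \<in> SSYT (m # \<mu>) \<longleftrightarrow>
     length r = m \<and> sorted r \<and> T \<in> SSYT \<mu> \<and> column_strict r (first_row T)"
proof -
  define C :: "nat list list \<Rightarrow> nat \<Rightarrow> bool" where
    "C U i \<longleftrightarrow> (Suc i < length U \<longrightarrow> column_strict (U ! i) (U ! Suc i))" for U i
  have SSYT: "U \<in> SSYT lam \<longleftrightarrow> map length U = lam \<and> (\<forall>row\<in>set U. sorted row) \<and> (\<forall>i. C U i)" for U lam
    unfolding SSYT_def C_def column_strict_def by blast
  have "(\<forall>i. C (r # T) i) \<longleftrightarrow> C (r # T) 0 \<and> (\<forall>i. C (r # T) (Suc i))"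
    by (rule all_nat_split)
  also have "C (r # T) 0 \<longleftrightarrow> column_strict r (first_row T)"
    by (cases T) (auto simp: C_def column_strict_def)
  also have "(\<forall>i. C (r # T) (Suc i)) \<longleftrightarrow> (\<forall>i. C T i)"
    by (simp add: C_def)
  finally show ?thesis
    unfolding SSYT by auto
qed

lemma SSYT_ConsE:
  assumes "T \<in> SSYT (m # \<mu>)"
  obtains r T' where "T = r # T'" "length r = m" "sorted r" "T' \<in> SSYT \<mu>" "column_strict r (first_row T')"
  using assms by (cases T) (auto simp: Cons_in_SSYT_iff, auto simp: SSYT_def)

lemma length_first_row: "T \<in> SSYT \<mu> \<Longrightarrow> length (first_row T) = first_part \<mu>"
  by (cases T; cases \<mu>) (auto simp: SSYT_def)

lemma sorted_first_row: "T \<in> SSYT \<mu> \<Longrightarrow> sorted (first_row T)"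
  by (cases T) (auto simp: SSYT_def)

text \<open>
  In a sorted row this is the position of the leftmost entry exceeding \<open>x\<close>, or the length of the
  row if there is none: inserting \<open>x\<close> bumps that entry, respectively appends \<open>x\<close>.
\<close>

definition bump_pos :: "nat \<Rightarrow> nat list \<Rightarrow> nat" where
  "bump_pos x r = length (takeWhile (\<lambda>y. y \<le> x) r)"

definition row_insert :: "nat \<Rightarrow> nat list \<Rightarrow> nat list" where
  "row_insert x r = (let p = bump_pos x r in if p = length r then r @ [x] else r[p := x])"

fun insert_tableau :: "nat \<Rightarrow> nat list list \<Rightarrow> nat list list" where
  "insert_tableau x [] = [[x]]"
| "insert_tableau x (r # T) = row_insert x r #
     (let p = bump_pos x r in if p = length r then T else insert_tableau (r ! p) T)"

lemma bump_pos_le: "bump_pos x r \<le> length r"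
  by (simp add: bump_pos_def length_takeWhile_le)

lemma nth_before_bump_pos: "j < bump_pos x r \<Longrightarrow> r ! j \<le> x"
  unfolding bump_pos_def by (metis nth_mem set_takeWhileD takeWhile_nth)

lemma nth_after_bump_pos:
  assumes "sorted r" "bump_pos x r \<le> j" "j < length r"
  shows "x < r ! j"
proof -
  have "x < r ! bump_pos x r"
    using assms nth_length_takeWhile[of "\<lambda>y. y \<le> x" r] by (simp add: bump_pos_def)
  also have "\<dots> \<le> r ! j"
    using assms by (simp add: sorted_nth_mono)
  finally show ?thesis .
qed

lemma bump_pos_eqI:
  assumes "p \<le> length r" "\<And>j. j < p \<Longrightarrow> r ! j \<le> x" "p < length r \<Longrightarrow> x < r ! p"
  shows "bump_pos x r = p"
  unfolding bump_pos_def using assms by (subst takeWhile_eq_take_P_nth[where n = p]) auto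

lemma first_row_insert: "first_row (insert_tableau x T) = row_insert x (first_row T)"
  by (cases T) (simp_all add: row_insert_def bump_pos_def)

lemma nth_row_insert:
  "j < length r \<Longrightarrow> row_insert x r ! j = (if j = bump_pos x r then x else r ! j)"
  by (auto simp: row_insert_def Let_def nth_append nth_list_update)

lemma length_row_insert:
  "length (row_insert x r) = (if bump_pos x r = length r then Suc (length r) else length r)"
  by (simp add: row_insert_def Let_def)

lemma nth_row_insert_bump_pos: "row_insert x r ! bump_pos x r = x"
  using bump_pos_le[of x r] by (auto simp: row_insert_def Let_def)

lemma bump_pos_lt_length_row_insert: "bump_pos x r < length (row_insert x r)"
  using bump_pos_le[of x r] by (simp add: length_row_insert)

lemma sorted_row_insert:
  assumes "sorted r"
  shows "sorted (row_insert x r)"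
proof (cases "bump_pos x r = length r")
  case True
  then have "\<forall>y\<in>set r. y \<le> x"
    using nth_before_bump_pos by (metis in_set_conv_nth)
  with True assms show ?thesis
    by (simp add: row_insert_def sorted_append)
next
  case False
  let ?p = "bump_pos x r"
  show ?thesis
    unfolding sorted_iff_nth_mono
  proof (intro allI impI)
    fix i j assume ij: "i \<le> j" "j < length (row_insert x r)"
    with False have "i < length r" "j < length r" by (simp_all add: length_row_insert)
    moreover have "r ! i \<le> r ! j" using assms ij calculation by (simp add: sorted_nth_mono)
    moreover have "r ! i \<le> x" if "i < ?p" using nth_before_bump_pos that by blast
    moreover have "x \<le> r ! j" if "?p < j"
      using nth_after_bump_pos[OF assms, of x j] that calculation by simp
    ultimately show "row_insert x r ! i \<le> row_insert x r ! j"
      using ij by (auto simp: nth_row_insert)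
  qed
qed

lemma row_insert_le:
  assumes "sorted r" "j < length r"
  shows "row_insert x r ! j \<le> r ! j"
  using assms nth_after_bump_pos[of r x "bump_pos x r"] by (auto simp: nth_row_insert)

lemma mset_row_insert:
  assumes "bump_pos x r < length r"
  shows "add_mset (r ! bump_pos x r) (mset (row_insert x r)) = add_mset x (mset r)"
  using assms by (simp add: row_insert_def Let_def mset_update)

lemma mset_insert_tableau:
  "mset (concat (insert_tableau x T)) = add_mset x (mset (concat T))"
proof (induction T arbitrary: x)
  case (Cons r T)
  show ?case
  proof (cases "bump_pos x r = length r")
    case True
    then show ?thesis by (simp add: row_insert_def)
  next
    case False
    with bump_pos_le[of x r] have "bump_pos x r < length r" by simp
    from mset_row_insert[OF this] False Cons show ?thesis
      by (simp add: union_mset_add_mset_left[symmetric] del: union_mset_add_mset_left)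
  qed
qed simp

text \<open>
  The bumping route moves weakly to the left: below the bumped entry stands a larger one, so the
  next row has an entry to be bumped at this column or earlier, or else ends before this column.
\<close>

lemma bump_pos_next_row:
  assumes "column_strict r r'" "sorted r'" "bump_pos x r < length r" "length r' \<le> length r"
  shows "bump_pos (r ! bump_pos x r) r' \<le> bump_pos x r"
proof (rule ccontr)
  let ?p = "bump_pos x r"
  assume "\<not> ?thesis"
  then have "?p < bump_pos (r ! ?p) r'" by simp
  then have "r' ! ?p \<le> r ! ?p" "?p < length r'"
    using nth_before_bump_pos bump_pos_le[of "r ! ?p" r'] by auto
  moreover from this(2) assms have "r ! ?p < r' ! ?p" by (simp add: column_strict_def)
  ultimately show False by simp
qed

text \<open>
  Insertion lowers existing entries, which can only endanger column-strictness at the column where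
  the bumped entry \<open>y\<close> lands in the next row.  That column is weakly left of the one that \<open>y\<close>
  came from, and there the new upper row has entries at most \<open>x < y\<close>.  The same fact bounds the
  length of the next row, so the shape stays a partition.
\<close>

lemma insert_tableau_in_SSYT:
  assumes "is_partition \<mu>" "T \<in> SSYT \<mu>"
  shows "\<exists>lam \<in> up_covers \<mu>. insert_tableau x T \<in> SSYT lam"
  using assms
proof (induction \<mu> arbitrary: T x)
  case Nil
  then show ?case
    by (simp add: SSYT_Nil up_covers_Nil Cons_in_SSYT_iff column_strict_def)
next
  case (Cons m \<mu>)
  from Cons.prems(2) obtain r T' where T: "T = r # T'" "length r = m" "sorted r"
      "T' \<in> SSYT \<mu>" "column_strict r (first_row T')"
    by (rule SSYT_ConsE)
  have \<mu>: "is_partition \<mu>" "first_part \<mu> \<le> m"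
    using Cons.prems(1) by (auto simp: is_partition_Cons)
  note len = length_first_row[OF T(4)] and sorted' = sorted_first_row[OF T(4)]
  let ?p = "bump_pos x r"
  show ?case
  proof (cases "?p = length r")
    case True
    then have "insert_tableau x T = (r @ [x]) # T'" "sorted (r @ [x])"
      using T sorted_row_insert[of r x] by (auto simp: row_insert_def)
    moreover have "column_strict (r @ [x]) (first_row T')"
      using T(2,5) \<mu>(2) len by (auto simp: column_strict_def nth_append)
    ultimately have "insert_tableau x T \<in> SSYT (Suc m # \<mu>)"
      using T by (simp add: Cons_in_SSYT_iff)
    then show ?thesis
      using up_covers_Cons[OF Cons.prems(1)] by blast
  next
    case False
    then have p: "?p < length r" using bump_pos_le[of x r] by simp
    let ?y = "r ! ?p" and ?r' = "first_row T'"
    obtain lam where lam: "lam \<in> up_covers \<mu>" "insert_tableau ?y T' \<in> SSYT lam"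
      using Cons.IH[OF \<mu>(1) T(4)] by blast
    have q: "bump_pos ?y ?r' \<le> ?p"
      using bump_pos_next_row[OF T(5) sorted' p] len \<mu>(2) T(2) by simp
    have "first_part lam = length (row_insert ?y ?r')"
      using length_first_row[OF lam(2)] by (simp add: first_row_insert)
    then have "first_part lam \<le> m"
      using q p len \<mu>(2) T(2) by (auto simp: length_row_insert)
    moreover have "column_strict (row_insert x r) (row_insert ?y ?r')"
      unfolding column_strict_def
    proof (intro allI impI, elim conjE)
      fix j assume j: "j < length (row_insert x r)" "j < length (row_insert ?y ?r')"
      then have jr: "j < length r" using False by (simp add: length_row_insert)
      show "row_insert x r ! j < row_insert ?y ?r' ! j"
      proof (cases "j = bump_pos ?y ?r'")
        case True
        have "row_insert x r ! j \<le> x"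
          using jr q True nth_before_bump_pos[of j x r] by (auto simp: nth_row_insert)
        also have "x < ?y"
          using nth_after_bump_pos[OF T(3), of x ?p] p by simp
        finally show ?thesis using True nth_row_insert_bump_pos by simp
      next
        case False
        with j have j': "j < length ?r'"
          by (auto simp: length_row_insert split: if_splits)
        have "row_insert x r ! j \<le> r ! j" using row_insert_le T(3) jr by blast
        also have "\<dots> < ?r' ! j" using T(5) jr j' by (simp add: column_strict_def)
        finally show ?thesis using False j' by (simp add: nth_row_insert)
      qed
    qed
    ultimately have "insert_tableau x T \<in> SSYT (m # lam)" "m # lam \<in> up_covers (m # \<mu>)"
      using T lam False sorted_row_insert[OF T(3), of x] up_covers_Cons[OF Cons.prems(1)]
      by (auto simp: Cons_in_SSYT_iff first_row_insert length_row_insert)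
    then show ?thesis by blast
  qed
qed

text \<open>
  The position of an insertion can be read off from the resulting row and the bumped entry: \<open>x\<close>
  now stands at the last position whose entry is less than the bumped one.  This makes row
  insertion reversible.
\<close>

lemma length_smaller_than_bumped:
  assumes "sorted r" "bump_pos x r < length r"
  shows "length (takeWhile (\<lambda>z. z < r ! bump_pos x r) (row_insert x r)) = Suc (bump_pos x r)"
proof -
  let ?p = "bump_pos x r"
  have "x < r ! ?p" using assms nth_after_bump_pos by blast
  then have "takeWhile (\<lambda>z. z < r ! ?p) (row_insert x r) = take (Suc ?p) (row_insert x r)"
    using assms nth_before_bump_pos[of _ x r]
    by (intro takeWhile_eq_take_P_nth)
      (auto simp: nth_row_insert length_row_insert sorted_nth_mono not_less less_Suc_eq
        intro: le_less_trans)
  then show ?thesis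
    using assms by (simp add: length_row_insert)
qed

lemma row_insert_inject:
  assumes "sorted r" "bump_pos x r < length r" "sorted r'" "bump_pos x' r' < length r'"
    and "row_insert x r = row_insert x' r'" "r ! bump_pos x r = r' ! bump_pos x' r'"
  shows "x = x' \<and> r = r'"
proof -
  have p: "bump_pos x r = bump_pos x' r'"
    using length_smaller_than_bumped[OF assms(1,2)] length_smaller_than_bumped[OF assms(3,4)] assms(5,6)
    by simp
  then have "x = x'"
    using nth_row_insert_bump_pos assms(5) by metis
  moreover have "r = (row_insert x r)[bump_pos x r := r ! bump_pos x r]"
      "r' = (row_insert x' r')[bump_pos x' r' := r' ! bump_pos x' r']"
    using assms(2,4) by (simp_all add: row_insert_def)
  ultimately show ?thesis
    using p assms(5,6) by metis
qed

text \<open>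
  The length of the first row of the result tells whether \<open>x\<close> was appended or bumped an entry; in
  the second case the bumped entry is recovered from the remaining rows by induction.
\<close>

lemma insert_tableau_inject:
  assumes "is_partition \<mu>" "T \<in> SSYT \<mu>" "T' \<in> SSYT \<mu>" "insert_tableau x T = insert_tableau x' T'"
  shows "x = x' \<and> T = T'"
  using assms
proof (induction \<mu> arbitrary: T T' x x')
  case Nil
  then show ?case by (simp add: SSYT_Nil)
next
  case (Cons m \<mu>)
  from Cons.prems(2) obtain r U where T: "T = r # U" "length r = m" "sorted r" "U \<in> SSYT \<mu>"
    by (rule SSYT_ConsE)
  from Cons.prems(3) obtain r' U' where T': "T' = r' # U'" "length r' = m" "sorted r'" "U' \<in> SSYT \<mu>"
    by (rule SSYT_ConsE)
  have rows: "row_insert x r = row_insert x' r'"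
    using Cons.prems(4) T T' by simp
  then have "length (row_insert x r) = length (row_insert x' r')" by simp
  then have same: "bump_pos x r = m \<longleftrightarrow> bump_pos x' r' = m"
    unfolding length_row_insert T(2) T'(2) by presburger
  show ?case
  proof (cases "bump_pos x r = m")
    case True
    with same have "bump_pos x' r' = m" by simp
    with True rows Cons.prems(4) T T' show ?thesis
      by (simp add: row_insert_def)
  next
    case False
    with same have False': "bump_pos x' r' \<noteq> m" by simp
    have "insert_tableau (r ! bump_pos x r) U = insert_tableau (r' ! bump_pos x' r') U'"
      using Cons.prems(4) T T' False False' by simp
    then have "r ! bump_pos x r = r' ! bump_pos x' r' \<and> U = U'"
      using Cons.IH[of U U'] T(4) T'(4) Cons.prems(1) by (simp add: is_partition_Cons)
    moreover have "bump_pos x r < length r" "bump_pos x' r' < length r'"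
      using False False' T(2) T'(2) bump_pos_le[of x r] bump_pos_le[of x' r'] by auto
    ultimately show ?thesis
      using row_insert_inject T T' rows by blast
  qed
qed

text \<open>
  Reverse insertion.  If the shapes differ in the first row, its last entry was the inserted one.
  Otherwise the rows below arise, by induction, from inserting some \<open>y\<close>.  Here \<open>y\<close> exceeds the entry
  above its column, so the first row \<open>s\<close> has an entry less than \<open>y\<close>; the last such entry is the
  inserted \<open>x\<close>, and \<open>y\<close> is put back in its place.
\<close>

lemma insert_tableau_surj:
  assumes "is_partition \<mu>" "lam \<in> up_covers \<mu>" "T' \<in> SSYT lam"
  shows "\<exists>x. \<exists>T \<in> SSYT \<mu>. insert_tableau x T = T'"
  using assms
proof (induction \<mu> arbitrary: lam T')
  case Nil
  then have "T' \<in> SSYT [1]" by (simp add: up_covers_Nil)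
  then obtain r U where "T' = r # U" "length r = 1" "U \<in> SSYT []"
    by (rule SSYT_ConsE)
  then show ?case by (auto simp: SSYT_Nil length_Suc_conv)
next
  case (Cons m \<mu>)
  have \<mu>: "is_partition \<mu>" "first_part \<mu> \<le> m"
    using Cons.prems(1) by (auto simp: is_partition_Cons)
  consider (append) "lam = Suc m # \<mu>"
    | (bump) lam' where "lam = m # lam'" "lam' \<in> up_covers \<mu>" "first_part lam' \<le> m"
    using Cons.prems(2) up_covers_Cons[OF Cons.prems(1)] by auto
  then show ?case
  proof cases
    case append
    with Cons.prems(3) have "T' \<in> SSYT (Suc m # \<mu>)" by simp
    then obtain s U where T': "T' = s # U" "length s = Suc m" "sorted s" "U \<in> SSYT \<mu>"
        "column_strict s (first_row U)"
      by (rule SSYT_ConsE)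
    obtain r x where s: "s = r @ [x]" "length r = m"
      using T'(2) by (metis length_Suc_conv_rev)
    have "bump_pos x r = length r"
      using T'(3) s by (intro bump_pos_eqI) (auto simp: sorted_append)
    then have "insert_tableau x (r # U) = T'"
      using T' s by (simp add: row_insert_def)
    moreover have "column_strict r (first_row U)"
      using T'(5) s by (auto simp: column_strict_def nth_append) (metis less_Suc_eq)
    then have "r # U \<in> SSYT (m # \<mu>)"
      using T' s by (simp add: Cons_in_SSYT_iff sorted_append)
    ultimately show ?thesis by blast
  next
    case bump
    with Cons.prems(3) have "T' \<in> SSYT (m # lam')" by simp
    then obtain s U where T': "T' = s # U" "length s = m" "sorted s" "U \<in> SSYT lam'"
        "column_strict s (first_row U)"
      by (rule SSYT_ConsE)
    obtain y V where V: "V \<in> SSYT \<mu>" "insert_tableau y V = U"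
      using Cons.IH[OF \<mu>(1) bump(2) T'(4)] by blast
    let ?r' = "first_row V" and ?a = "length (takeWhile (\<lambda>x. x < y) s)"
    let ?q = "bump_pos y ?r'"
    note len = length_first_row[OF V(1)] and sorted' = sorted_first_row[OF V(1)]
    have firstU: "first_row U = row_insert y ?r'"
      using V(2) first_row_insert by auto
    have q: "?q < m"
      using bump_pos_lt_length_row_insert[of y ?r'] length_first_row[OF T'(4)] bump(3) firstU by simp
    then have "s ! ?q < y"
      using T'(2,5) bump_pos_lt_length_row_insert[of y ?r'] nth_row_insert_bump_pos[of y ?r']
      unfolding firstU column_strict_def by metis
    have "?q < ?a"
    proof (rule ccontr)
      assume "\<not> ?q < ?a"
      then have "?a < length s" "s ! ?a \<le> s ! ?q"
        using q T'(2,3) by (auto simp: sorted_nth_mono)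
      with \<open>s ! ?q < y\<close> show False
        using nth_length_takeWhile[of "\<lambda>x. x < y" s] by simp
    qed
    \<comment> \<open>The last position with an entry less than \<open>y\<close>; it exists because \<open>?q < ?a\<close>.\<close>
    define p where "p = ?a - 1"
    have p: "?q \<le> p" "p < ?a" using \<open>?q < ?a\<close> by (auto simp: p_def)
    have pm: "p < m" using p length_takeWhile_le[of "\<lambda>x. x < y" s] T'(2) by simp
    have below: "s ! j < y" if "j < ?a" for j
      using that by (metis nth_mem set_takeWhileD takeWhile_nth)
    have above: "y \<le> s ! j" if "p < j" "j < m" for j
    proof -
      have "?a \<le> j" using that p by (simp add: p_def)
      then have "?a < length s" "s ! ?a \<le> s ! j"
        using that T'(2,3) by (auto simp: sorted_nth_mono)
      then show ?thesis
        using nth_length_takeWhile[of "\<lambda>x. x < y" s] by simp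
    qed
    let ?x = "s ! p" and ?r = "s[p := y]"
    have "sorted ?r"
      unfolding sorted_iff_nth_mono
    proof (intro allI impI)
      fix i j assume "i \<le> j" "j < length ?r"
      then show "?r ! i \<le> ?r ! j"
        using T'(2,3) below[of i] above[of j] p
        by (cases "i = p"; cases "j = p") (auto simp: sorted_nth_mono)
    qed
    have pos: "bump_pos ?x ?r = p"
      using pm p T'(2,3) below[of p] by (intro bump_pos_eqI) (auto simp: sorted_nth_mono)
    then have "insert_tableau ?x (?r # V) = T'"
      using T' V pm by (simp add: row_insert_def)
    moreover have "column_strict ?r ?r'"
      unfolding column_strict_def
    proof (intro allI impI, elim conjE)
      fix j assume j: "j < length ?r" "j < length ?r'"
      show "?r ! j < ?r' ! j"
      \<comment> \<open>At column \<open>p\<close> the entry \<open>y\<close> meets \<open>V\<close>, whose first row exceeds \<open>y\<close> from \<open>?q \<le> p\<close> on.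
        Elsewhere the upper row is unchanged, and the entries below only grow when \<open>y\<close> is removed.\<close>
      proof (cases "j = p")
        case True
        then show ?thesis
          using nth_after_bump_pos[OF sorted', of y p] p j by simp
      next
        case False
        have "s ! j < row_insert y ?r' ! j"
          using T'(5) j firstU by (simp add: column_strict_def length_row_insert)
        also have "\<dots> \<le> ?r' ! j" using row_insert_le[OF sorted' j(2)] .
        finally show ?thesis using False by simp
      qed
    qed
    then have "?r # V \<in> SSYT (m # \<mu>)"
      using \<open>sorted ?r\<close> V T' by (simp add: Cons_in_SSYT_iff)
    ultimately show ?thesis by blast
  qed
qed

lemma bij_betw_insert_tableau:
  assumes "is_partition \<mu>"
  shows "bij_betw (\<lambda>(x, T). insert_tableau x T) (UNIV \<times> SSYT \<mu>) (\<Union>lam\<in>up_covers \<mu>. SSYT lam)"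
  unfolding bij_betw_def
proof
  show "inj_on (\<lambda>(x, T). insert_tableau x T) (UNIV \<times> SSYT \<mu>)"
    using insert_tableau_inject[OF assms] by (force simp: inj_on_def)
  show "(\<lambda>(x, T). insert_tableau x T) ` (UNIV \<times> SSYT \<mu>) = (\<Union>lam\<in>up_covers \<mu>. SSYT lam)"
    using insert_tableau_in_SSYT[OF assms] insert_tableau_surj[OF assms] by force
qed

section \<open>Generating series\<close>

text \<open>
  The next lemmas turn weight-preserving bijections, disjoint unions and products of sets into
  identities of series.  The latter two need finite fibres because \<^const>\<open>card\<close> is 0 on infinite sets.
\<close>

lemma gen_series_bij:
  assumes "bij_betw f A B" "\<And>a. a \<in> A \<Longrightarrow> w (f a) = v a"
  shows "gen_series A v = gen_series B w"
proof -
  have "card {a \<in> A. v a = M} = card {b \<in> B. w b = M}" for M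
  proof (rule bij_betw_same_card)
    show "bij_betw f {a \<in> A. v a = M} {b \<in> B. w b = M}"
    proof (rule bij_betw_subset[OF assms(1)])
      have "f ` A = B" using assms(1) by (simp add: bij_betw_def)
      with assms(2) show "f ` {a \<in> A. v a = M} = {b \<in> B. w b = M}" by force
    qed blast
  qed
  then show ?thesis by (simp add: coeff_inject[symmetric] fun_eq_iff gen_series.rep_eq)
qed

lemma coeff_sum: "coeff (\<Sum>i\<in>I. F i) M = (\<Sum>i\<in>I. coeff (F i) M)"
  by (induction I rule: infinite_finite_induct)
    (simp_all add: zero_power_series.rep_eq plus_power_series.rep_eq)

lemma gen_series_UN:
  assumes "finite I" "\<And>i M. i \<in> I \<Longrightarrow> finite {a \<in> A i. w a = M}"
    and "\<And>i j. i \<in> I \<Longrightarrow> j \<in> I \<Longrightarrow> i \<noteq> j \<Longrightarrow> A i \<inter> A j = {}"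
  shows "gen_series (\<Union>i\<in>I. A i) w = (\<Sum>i\<in>I. gen_series (A i) w)"
proof -
  have "card {a \<in> \<Union>i\<in>I. A i. w a = M} = (\<Sum>i\<in>I. card {a \<in> A i. w a = M})" for M
  proof -
    have "{a \<in> \<Union>i\<in>I. A i. w a = M} = (\<Union>i\<in>I. {a \<in> A i. w a = M})" by blast
    moreover have "card \<dots> = (\<Sum>i\<in>I. card {a \<in> A i. w a = M})"
      using assms by (intro card_UN_disjoint) fastforce+
    ultimately show ?thesis by simp
  qed
  then show ?thesis
    by (simp add: coeff_inject[symmetric] fun_eq_iff coeff_sum gen_series.rep_eq)
qed

lemma gen_series_times:
  assumes "\<And>M. finite {a \<in> A. v a = M}" "\<And>M. finite {b \<in> B. w b = M}"
  shows "gen_series A v * gen_series B w = gen_series (A \<times> B) (\<lambda>(a, b). v a + w b)"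
proof -
  have "card {p \<in> A \<times> B. (\<lambda>(a, b). v a + w b) p = M}
      = (\<Sum>N | N \<subseteq># M. card {a \<in> A. v a = N} * card {b \<in> B. w b = M - N})" for M
  proof -
    have "{p \<in> A \<times> B. (\<lambda>(a, b). v a + w b) p = M}
        = (\<Union>N\<in>{N. N \<subseteq># M}. {a \<in> A. v a = N} \<times> {b \<in> B. w b = M - N})"
      by auto
    moreover have "card \<dots> = (\<Sum>N | N \<subseteq># M. card {a \<in> A. v a = N} * card {b \<in> B. w b = M - N})"
      using assms by (subst card_UN_disjoint) (auto simp: finite_submultisets card_cartesian_product)
    ultimately show ?thesis by simp
  qed
  then show ?thesis by transfer (simp add: fun_eq_iff)
qed

lemma complete_h_1: "complete_h 1 = gen_series UNIV (\<lambda>x. {#x#})"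
  unfolding complete_h_def
  by (rule gen_series_bij[symmetric, where f = "\<lambda>x. [x]"])
    (auto simp: bij_betw_def inj_on_def length_Suc_conv)

lemma schur_row: "schur (row_cons n []) = complete_h n"
proof (cases "n = 0")
  case True
  have "SSYT [] = {[]}" by (rule SSYT_Nil)
  moreover have "{is. sorted is \<and> length is = 0} = {[] :: nat list}" by auto
  ultimately show ?thesis
    unfolding True schur_def complete_h_def row_cons_simps
    by (intro gen_series_bij[where f = "\<lambda>_. []"]) auto
next
  case False
  have "bij_betw (\<lambda>r. [r]) {is. sorted is \<and> length is = n} (SSYT [n])"
    by (auto simp: bij_betw_def inj_on_def Cons_in_SSYT_iff SSYT_Nil column_strict_def elim!: SSYT_ConsE)
  with False show ?thesis
    unfolding schur_def complete_h_def
    by (simp, intro gen_series_bij[symmetric]) auto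
qed

text \<open>
  The Pieri rule for \<open>h\<^sub>1\<close>: a pair of a letter and a tableau corresponds under row insertion to a
  tableau with one more box, with the letter's weight added.
\<close>

lemma schur_pieri:
  assumes "is_partition \<mu>"
  shows "up_sum schur \<mu> = complete_h 1 * schur \<mu>"
proof -
  have "inj (\<lambda>x :: nat. {#x#})" by (simp add: inj_def)
  from finite_vimageI[OF _ this, of "{M}" for M]
  have singletons: "finite {x :: nat \<in> UNIV. {#x#} = M}" for M
    by (simp add: vimage_def)
  have "complete_h 1 * schur \<mu> = gen_series (UNIV \<times> SSYT \<mu>) (\<lambda>(x, T). {#x#} + mset (concat T))"
    unfolding complete_h_1 schur_def
    by (intro gen_series_times finite_SSYT_fibre singletons)
  also have "\<dots> = gen_series (\<Union>lam\<in>up_covers \<mu>. SSYT lam) (\<lambda>T. mset (concat T))"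
    by (rule gen_series_bij[OF bij_betw_insert_tableau[OF assms]]) (auto simp: mset_insert_tableau)
  also have "\<dots> = up_sum schur \<mu>"
    unfolding up_sum_def schur_def
    by (intro gen_series_UN finite_up_covers finite_SSYT_fibre) (auto simp: SSYT_def)
  finally show ?thesis by simp
qed

theorem theorem8:
  fixes n k :: nat
  assumes "n \<ge> 1"
  shows "(\<Sum>lam \<in> Lam n k. of_nat (num_vacillating n k lam) * schur lam) =
         (\<Sum>j = 0..min n k. of_nat (Stirling k j) * complete_h_partition (hook n j))"
proof -
  have n: "is_partition [n]" "[n] \<turnstile>\<^sub>p n"
    using assms by (auto simp: is_partition_Cons partition_of_def)
  have num: "num_vacillating n k lam = card (walks k [n] lam)" for lam
    by (simp add: num_vacillating_def vacillating_tableaux_def walks_def)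
  have "card (walks k [n] lam) = 0" if "lam \<turnstile>\<^sub>p n" "lam \<notin> Lam n k" for lam
    using walks_shape[OF n(1), of k lam] that by (fastforce simp: Lam_def)
  then have "(\<Sum>lam \<in> Lam n k. of_nat (num_vacillating n k lam) * schur lam)
      = (\<Sum>lam | lam \<turnstile>\<^sub>p n. of_nat (card (walks k [n] lam)) * schur lam)"
    unfolding num by (intro sum.mono_neutral_left finite_partitions) (auto simp: Lam_def)
  also have "\<dots> = ((\<lambda>\<psi>. down_sum (up_sum \<psi>)) ^^ k) schur [n]"
    by (rule sum_walks[OF n(2)])
  also have "\<dots> = (\<Sum>j\<le>k. of_nat (Stirling k j) * complete_h 1 ^ j * (down_sum ^^ j) schur (row_cons n []))"
    using assms by (subst down_up_power_Stirling[OF schur_pieri n(1)]) simp_all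
  also have "\<dots> = (\<Sum>j\<le>k. if j \<le> n then of_nat (Stirling k j) * complete_h_partition (hook n j) else 0)"
    by (intro sum.cong) (auto simp: down_power_row schur_row complete_h_hook)
  also have "\<dots> = (\<Sum>j = 0..min n k. of_nat (Stirling k j) * complete_h_partition (hook n j))"
    by (intro sum.mono_neutral_cong_right) auto
  finally show ?thesis .
qed

end
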